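(* Let $\hat u^{st}(y_l)$, $l=0,\dots,R$, be the space-time reconstructions at the quadrature points, $\mathcal{R}^{st}(y_l)=\partial_t\hat u^{st}(y_l)+\partial_xf(\hat u^{st}(y_l))$ their space-time residuals, $\hat u^{st}_i$ the reconstructed modes, $\hat u^{sts}=\sum_{i=0}^M\hat u_i^{st}\Psi_i$ the space-time-stochastic reconstruction and $\mathcal{R}^{sts}=\partial_t\hat u^{sts}+\partial_xf(\hat u^{sts})$ the space-time-stochastic residual (see context). Then $\mathcal{R}^{sts}$ admits the orthogonal decomposition $$\mathcal{R}^{sts}=\sum_{j=0}^M\big(\mathcal{R}^{det}_j+\mathcal{R}^{sq}_j\big)\Psi_j+\sum_{j>M}\mathcal{R}^{sc}_j\Psi_j,$$ where $$\mathcal{R}^{det}_j:=\sum_{l=0}^R\mathcal{R}^{st}(y_l)\Psi_j(y_l)w_l,\qquad j=0,\dots,M,$$ $$\mathcal{R}^{sq}_j:=\Big\langle\partial_xf\Big(\sum_{i=0}^M\hat u^{st}_i\Psi_i\Big),\Psi_j\Big\rangle-\sum_{l=0}^R\partial_xf(\hat u^{st}(y_l))\Psi_j(y_l)w_l,\qquad j=0,\dots,M,$$ $$\mathcal{R}^{sc}_j:=\Big\langle\partial_xf\Big(\sum_{i=0}^M\hat u^{st}_i\Psi_i\Big),\Psi_j\Big\rangle,\qquad j>M.$$ Moreover, for every $t\in(0,T)$, with $\mathcal{E}^{sts}(t):=\|\mathcal{R}^{sts}\|^2_{L^2_\xi(\Xi;L^2((0,t)\times\mathbb{R}))}$, $$\mathcal{E}^{sts}(t)=\sum_{j=0}^M\|\mathcal{R}^{det}_j+\mathcal{R}^{sq}_j\|^2_{L^2((0,t)\times\mathbb{R})}+\sum_{j>M}\|\mathcal{R}^{sc}_j\|^2_{L^2((0,t)\times\mathbb{R})}\le2\mathcal{E}^{det}(t)+2\mathcal{E}^{sq}(t)+\mathcal{E}^{sc}(t),$$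 where $\mathcal{E}^{det}(t):=\sum_{j=0}^M\|\mathcal{R}^{det}_j\|^2_{L^2((0,t)\times\mathbb{R})}$, $\mathcal{E}^{sq}(t):=\sum_{j=0}^M\|\mathcal{R}^{sq}_j\|^2_{L^2((0,t)\times\mathbb{R})}$ and $\mathcal{E}^{sc}(t):=\sum_{j>M}\|\mathcal{R}^{sc}_j\|^2_{L^2((0,t)\times\mathbb{R})}$.
   Context: Random space. $\xi$ is a random variable with values in $\Xi\subset\mathbb{R}$ and probability density $w_\xi:\Xi\to\mathbb{R}_+$. For a normed space $E$, $\|g\|_{L^2_\xi(\Xi;E)}^2=\int_\Xi\|g(y)\|_E^2\,w_\xi(y)\,dy$. $\{\Psi_i\}_{i\in\mathbb{N}}$, $\mathbb{N}=\{0,1,2,\dots\}$, is an orthonormal basis of $L^2_\xi(\Xi)$; $\langle g,h\rangle:=\int_\Xi g(y)h(y)w_\xi(y)\,dy$ (componentwise in $\mathbb{R}^m$, pointwise in $(t,x)$), so $\langle\Psi_i,\Psi_j\rangle=\delta_{ij}$. Equation and discretization. $T\in(0,\infty)$, $\mathcal{U}\subset\mathbb{R}^m$ is open, $f\in C^2(\mathcal{U};\mathbb{R}^m)$ is the flux of the strictly hyperbolic system $\partial_tu+\partial_xf(u)=0$ on $(0,T)\times\mathbb{R}\times\Xi$. $M,R\in\mathbb{N}$; $y_0,\dots,y_R\in\Xi$ are quadrature points with weights $w_0,\dots,w_R\in\mathbb{R}$. $V_{p}^s$ is the space of functions $\mathbb{R}\to\mathbb{R}^m$ that are polynomials of degree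 $\le p$ on each cell of a uniform triangulation of $\mathbb{R}$. Reconstruction. For each $l=0,\dots,R$ a space-time reconstruction $\hat u^{st}(y_l)\in W^1_\infty((0,T);V^s_{p+1}\cap C^0(\mathbb{R}))$ of a Runge–Kutta Discontinuous Galerkin numerical solution at the quadrature point $y_l$ is given (a function Lipschitz continuous in space and time, with values in $\mathcal{U}$), with $\mathcal{R}^{st}(y_l)\in L^2((0,T)\times\mathbb{R};\mathbb{R}^m)$. The reconstructed modes are $\hat u_i^{st}=\sum_{l=0}^R\hat u^{st}(y_l)\Psi_i(y_l)w_l$, $i=0,\dots,M$. The function $\hat u^{sts}(t,x,y)=\sum_{i=0}^M\hat u^{st}_i(t,x)\Psi_i(y)$ takes values in $\mathcal{U}$, and $\mathcal{R}^{sts}\in L^2_\xi(\Xi;L^2((0,T)\times\mathbb{R};\mathbb{R}^m))$. The series in the decomposition is understood in $L^2_\xi(\Xi;L^2((0,T)\times\mathbb{R};\mathbb{R}^m))$. *)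

theory Defs
  imports "HOL-Probability.Probability"
begin

section \<open>Flux function\<close>

definition C2_on :: "'a::real_normed_vector set \<Rightarrow> ('a \<Rightarrow> 'b::real_normed_vector) \<Rightarrow> bool" where
  "C2_on U f \<longleftrightarrow> (\<exists>(f' :: 'a \<Rightarrow> 'a \<Rightarrow>\<^sub>L 'b) (f'' :: 'a \<Rightarrow> 'a \<Rightarrow>\<^sub>L ('a \<Rightarrow>\<^sub>L 'b)).
     (\<forall>u\<in>U. (f has_derivative blinfun_apply (f' u)) (at u)) \<and>
     (\<forall>u\<in>U. (f' has_derivative blinfun_apply (f'' u)) (at u)) \<and>
     continuous_on U f'')"

text \<open>The Jacobian of the flux has \<open>m = CARD('m)\<close> distinct real eigenvalues at every state.\<close>

definition strictly_hyperbolic :: "(real^'m) set \<Rightarrow> (real^'m \<Rightarrow> real^'m) \<Rightarrow> bool" where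
  "strictly_hyperbolic U f \<longleftrightarrow>
     (\<forall>u\<in>U. card {\<kappa>::real. \<exists>v. v \<noteq> 0 \<and> frechet_derivative f (at u) v = \<kappa> *\<^sub>R v} = CARD('m))"

section \<open>Square integrable functions\<close>

text \<open>Squared norms are \<open>ennreal\<close>-valued, so that they and countable sums of them are always
  meaningful; \<open>in_L2\<close> is membership of a representative, that is, measurability together with a
  finite norm.\<close>

definition L2_normsq :: "'a measure \<Rightarrow> ('a \<Rightarrow> 'b::euclidean_space) \<Rightarrow> ennreal" where
  "L2_normsq S g = (\<integral>\<^sup>+z. ennreal ((norm (g z))\<^sup>2) \<partial>S)"

definition in_L2 :: "'a measure \<Rightarrow> ('a \<Rightarrow> 'b::euclidean_space) \<Rightarrow> bool" where
  "in_L2 S g \<longleftrightarrow> g \<in> borel_measurable S \<and> L2_normsq S g < \<infinity>"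

text \<open>The weighted measure \<open>w(y) dy\<close> on \<open>\<Xi>\<close>, so that \<open>L2_normsq (weighted \<Xi> w)\<close> is the squared
  norm of \<open>L\<^sup>2\<^sub>\<xi>(\<Xi>)\<close>.\<close>

definition weighted :: "real set \<Rightarrow> (real \<Rightarrow> real) \<Rightarrow> real measure" where
  "weighted \<Xi> w = density (restrict_space lborel \<Xi>) (\<lambda>y. ennreal (w y))"

text \<open>The space-time slab \<open>(0,t) \<times> \<real>\<close> with Lebesgue measure.\<close>

definition slab :: "real \<Rightarrow> (real \<times> real) measure" where
  "slab t = lebesgue_on ({0<..<t} \<times> UNIV)"

text \<open>The space \<open>L\<^sup>2(\<mu>; L\<^sup>2(S))\<close>: an element is represented by \<open>g\<close>, where \<open>g y\<close> is a function on
  \<open>S\<close>. Strong measurability of \<open>y \<mapsto> g y\<close> as an \<open>L\<^sup>2(S)\<close>-valued map is expressed by joint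
  measurability of the representative.\<close>

definition L2_L2_normsq ::
    "'y measure \<Rightarrow> 'z measure \<Rightarrow> ('y \<Rightarrow> 'z \<Rightarrow> 'b::euclidean_space) \<Rightarrow> ennreal" where
  "L2_L2_normsq \<mu> S g = (\<integral>\<^sup>+y. L2_normsq S (g y) \<partial>\<mu>)"

definition in_L2_L2 ::
    "'y measure \<Rightarrow> 'z measure \<Rightarrow> ('y \<Rightarrow> 'z \<Rightarrow> 'b::euclidean_space) \<Rightarrow> bool" where
  "in_L2_L2 \<mu> S g \<longleftrightarrow>
     (\<lambda>(y, z). g y z) \<in> borel_measurable (\<mu> \<Otimes>\<^sub>M S) \<and> L2_L2_normsq \<mu> S g < \<infinity>"

definition L2_L2_inner ::
    "'y measure \<Rightarrow> 'z measure \<Rightarrow> ('y \<Rightarrow> 'z \<Rightarrow> 'b::euclidean_space) \<Rightarrow> ('y \<Rightarrow> 'z \<Rightarrow> 'b) \<Rightarrow> real" where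
  "L2_L2_inner \<mu> S g h = (LINT y|\<mu>. (LINT z|S. g y z \<bullet> h y z))"

text \<open>The bracket \<open>\<langle>g, h\<rangle>\<close> of a vector valued \<open>g\<close> and a scalar \<open>h\<close>; the Bochner integral acts
  componentwise.\<close>

definition bracket :: "'y measure \<Rightarrow> ('y \<Rightarrow> 'b::euclidean_space) \<Rightarrow> ('y \<Rightarrow> real) \<Rightarrow> 'b" where
  "bracket \<mu> g h = (LINT y|\<mu>. h y *\<^sub>R g y)"

definition L2_orthonormal_basis :: "'y measure \<Rightarrow> (nat \<Rightarrow> 'y \<Rightarrow> real) \<Rightarrow> bool" where
  "L2_orthonormal_basis \<mu> \<Psi> \<longleftrightarrow>
     (\<forall>i. in_L2 \<mu> (\<Psi> i)) \<and>
     (\<forall>i j. bracket \<mu> (\<Psi> i) (\<Psi> j) = (if i = j then 1 else 0)) \<and>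
     (\<forall>g::'y \<Rightarrow> real. in_L2 \<mu> g \<longrightarrow>
        (\<forall>\<epsilon>>0. \<exists>n c. L2_normsq \<mu> (\<lambda>y. g y - (\<Sum>i<n. c i * \<Psi> i y)) < ennreal \<epsilon>))"

section \<open>Reconstructions and residuals\<close>

text \<open>Piecewise polynomials of degree at most \<open>p\<close> on the uniform triangulation of the real line
  with nodes \<open>a + k h\<close>, \<open>k\<close> an integer; values at the nodes are not constrained.\<close>

definition dg_space :: "real \<Rightarrow> real \<Rightarrow> nat \<Rightarrow> (real \<Rightarrow> real^'m) set" where
  "dg_space a h p = {v. \<forall>k::int. \<exists>c :: nat \<Rightarrow> real^'m.
     \<forall>x\<in>{a + of_int k * h <..< a + of_int (k + 1) * h}. v x = (\<Sum>i\<le>p. x ^ i *\<^sub>R c i)}"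

text \<open>The space \<open>W\<^sup>1\<^sub>\<infinity>((0,T); X)\<close> for a space \<open>X\<close> of continuous piecewise polynomials:
  functions Lipschitz continuous in space and time, with values \<open>u(t,\<cdot>)\<close> in \<open>X\<close> and with a time
  derivative in \<open>X\<close> at almost every time. (For continuous piecewise polynomials the last clause
  already follows from the first two.)\<close>

definition W1_inf :: "real \<Rightarrow> (real \<Rightarrow> real^'m) set \<Rightarrow> (real \<Rightarrow> real \<Rightarrow> real^'m) set" where
  "W1_inf T X = {u.
     (\<forall>t\<in>{0<..<T}. u t \<in> X) \<and>
     (\<exists>L. L-lipschitz_on ({0<..<T} \<times> UNIV) (\<lambda>(t, x). u t x)) \<and>
     (AE t in lebesgue_on {0<..<T}. \<exists>v\<in>X. \<forall>x. ((\<lambda>s. u s x) has_vector_derivative v x) (at t))}"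

text \<open>Partial derivatives are taken pointwise. For the Lipschitz continuous functions considered
  here they exist almost everywhere and coincide with the weak ones.\<close>

definition d_t :: "(real \<Rightarrow> real \<Rightarrow> 'b::real_normed_vector) \<Rightarrow> real \<times> real \<Rightarrow> 'b" where
  "d_t u = (\<lambda>(t, x). vector_derivative (\<lambda>s. u s x) (at t))"

definition d_x :: "(real \<Rightarrow> real \<Rightarrow> 'b::real_normed_vector) \<Rightarrow> real \<times> real \<Rightarrow> 'b" where
  "d_x u = (\<lambda>(t, x). vector_derivative (\<lambda>\<zeta>. u t \<zeta>) (at x))"

definition d_x_flux :: "('b \<Rightarrow> 'b) \<Rightarrow> (real \<Rightarrow> real \<Rightarrow> 'b) \<Rightarrow> real \<times> real \<Rightarrow> 'b::real_normed_vector" where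
  "d_x_flux f u = d_x (\<lambda>t x. f (u t x))"

definition residual :: "('b \<Rightarrow> 'b) \<Rightarrow> (real \<Rightarrow> real \<Rightarrow> 'b) \<Rightarrow> real \<times> real \<Rightarrow> 'b::real_normed_vector" where
  "residual f u z = d_t u z + d_x_flux f u z"

end

theory Submission
  imports Defs
begin

text \<open>Parseval's identity holds for the scalar sections \<open>y \<mapsto> Rsts y z \<bullet> b\<close>; summing over
  the coordinates \<open>b\<close> and integrating over \<open>z\<close> by Tonelli gives it for the coefficients
  \<open>\<langle>Rsts(\<cdot>, z), \<Psi> j\<rangle>\<close>. These are the claimed ones: at almost every \<open>z\<close> the
  quadrature-point reconstructions are differentiable in time, so that \<open>d_t usts\<close> is a combination
  of \<open>\<Psi> 0, \<dots>, \<Psi> M\<close> and contributes \<open>\<Sum>l. \<Psi> j (yq l) wq l d_t (ust (yq l))\<close> for \<open>j \<le> M\<close>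
  and nothing for \<open>j > M\<close>. The spatial derivative of the flux is never computed, because it is the
  difference of the residual and the time derivative.\<close>

section \<open>Square integrable functions\<close>

lemma L2_normsq_conv_integral:
  assumes "in_L2 S g"
  shows "integrable S (\<lambda>z. (norm (g z))\<^sup>2)"
    and "L2_normsq S g = ennreal (LINT z|S. (norm (g z))\<^sup>2)"
proof -
  show *: "integrable S (\<lambda>z. (norm (g z))\<^sup>2)"
    using assms unfolding in_L2_def L2_normsq_def
    by (intro integrableI_nonneg) auto
  show "L2_normsq S g = ennreal (LINT z|S. (norm (g z))\<^sup>2)"
    unfolding L2_normsq_def by (rule nn_integral_eq_integral[OF *]) simp
qed

text \<open>The majorant \<open>(norm (g z))\<^sup>2 + (norm (h z))\<^sup>2\<close> comes from
  Cauchy-Schwarz followed by 2ab \<le> a^2 + b^2.\<close>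

lemma in_L2_inner_integrable:
  fixes g h :: "'a \<Rightarrow> 'b::euclidean_space"
  assumes "in_L2 S g" "in_L2 S h"
  shows "integrable S (\<lambda>z. g z \<bullet> h z)"
proof (rule Bochner_Integration.integrable_bound)
  show "integrable S (\<lambda>z. (norm (g z))\<^sup>2 + (norm (h z))\<^sup>2)"
    using assms by (intro Bochner_Integration.integrable_add L2_normsq_conv_integral(1))
  show "(\<lambda>z. g z \<bullet> h z) \<in> borel_measurable S"
    using assms unfolding in_L2_def by auto
  have "\<bar>x \<bullet> y\<bar> \<le> (norm x)\<^sup>2 + (norm y)\<^sup>2" for x y :: 'b
  proof -
    have "\<bar>x \<bullet> y\<bar> \<le> norm x * norm y" by (rule Cauchy_Schwarz_ineq2)
    moreover have "2 * norm x * norm y \<le> (norm x)\<^sup>2 + (norm y)\<^sup>2"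
      using sum_squares_bound[of "norm x" "norm y"] by simp
    moreover have "0 \<le> norm x * norm y" by simp
    ultimately show ?thesis by linarith
  qed
  then show "AE z in S. norm (g z \<bullet> h z) \<le> norm ((norm (g z))\<^sup>2 + (norm (h z))\<^sup>2)"
    by auto
qed

lemma in_L2_scaleR_integrable:
  fixes g :: "'a \<Rightarrow> 'b::euclidean_space" and h :: "'a \<Rightarrow> real"
  assumes "in_L2 S g" "in_L2 S h"
  shows "integrable S (\<lambda>z. h z *\<^sub>R g z)"
proof (rule Bochner_Integration.integrable_bound)
  have "in_L2 S (\<lambda>z. norm (g z))"
    using assms(1) unfolding in_L2_def L2_normsq_def by auto
  then show "integrable S (\<lambda>z. h z * norm (g z))"
    using in_L2_inner_integrable[OF assms(2), of "\<lambda>z. norm (g z)"] by simp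
  show "(\<lambda>z. h z *\<^sub>R g z) \<in> borel_measurable S"
    using assms unfolding in_L2_def by auto
qed (simp add: abs_mult)

lemma norm_add_sq_le: "(norm (x + y))\<^sup>2 \<le> 2 * (norm x)\<^sup>2 + 2 * (norm (y :: 'b::real_normed_vector))\<^sup>2"
proof -
  have "(norm (x + y))\<^sup>2 \<le> (norm x + norm y)\<^sup>2"
    by (rule power_mono) (auto simp: norm_triangle_ineq)
  also have "\<dots> \<le> 2 * (norm x)\<^sup>2 + 2 * (norm y)\<^sup>2"
    using sum_squares_bound[of "norm x" "norm y"] by (simp add: power2_sum)
  finally show ?thesis .
qed

text \<open>Integrates the pointwise bound \<open>norm_add_sq_le\<close>; this is the source of the
  factors 2 in the final estimate.\<close>

lemma L2_normsq_add_le: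
  assumes [measurable]: "g \<in> borel_measurable S" "h \<in> borel_measurable S"
  shows "L2_normsq S (\<lambda>z. g z + h z) \<le> 2 * L2_normsq S g + 2 * L2_normsq S h"
proof -
  have "L2_normsq S (\<lambda>z. g z + h z)
      \<le> (\<integral>\<^sup>+z. 2 * ennreal ((norm (g z))\<^sup>2) + 2 * ennreal ((norm (h z))\<^sup>2) \<partial>S)"
    unfolding L2_normsq_def
  proof (rule nn_integral_mono)
    fix z
    have "2 * ennreal ((norm (g z))\<^sup>2) + 2 * ennreal ((norm (h z))\<^sup>2)
        = ennreal (2 * (norm (g z))\<^sup>2 + 2 * (norm (h z))\<^sup>2)"
      by (simp add: ennreal_mult)
    then show "ennreal ((norm (g z + h z))\<^sup>2)
        \<le> 2 * ennreal ((norm (g z))\<^sup>2) + 2 * ennreal ((norm (h z))\<^sup>2)"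
      using norm_add_sq_le[of "g z" "h z"] by (simp only: ennreal_leI)
  qed
  also have "\<dots> = 2 * L2_normsq S g + 2 * L2_normsq S h"
    unfolding L2_normsq_def by (simp add: nn_integral_add nn_integral_cmult)
  finally show ?thesis .
qed

lemma in_L2_add:
  assumes "in_L2 S g" "in_L2 S h"
  shows "in_L2 S (\<lambda>z. g z + h z)"
proof -
  have "2 * L2_normsq S g + 2 * L2_normsq S h < \<infinity>"
    using assms unfolding in_L2_def by (auto simp: ennreal_mult_less_top)
  with L2_normsq_add_le[of g S h] assms show ?thesis
    unfolding in_L2_def by (auto intro: le_less_trans)
qed

lemma L2_normsq_scaleR:
  assumes "g \<in> borel_measurable S"
  shows "L2_normsq S (\<lambda>z. c *\<^sub>R g z) = ennreal (c\<^sup>2) * L2_normsq S g"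
  unfolding L2_normsq_def using assms
  by (subst nn_integral_cmult[symmetric]) (auto simp: power_mult_distrib ennreal_mult)

lemma in_L2_scaleR: "in_L2 S g \<Longrightarrow> in_L2 S (\<lambda>z. c *\<^sub>R g z)"
  using L2_normsq_scaleR[of g S c] unfolding in_L2_def
  by (auto simp: ennreal_mult_less_top)

lemma in_L2_minus:
  assumes "in_L2 S g" "in_L2 S h"
  shows "in_L2 S (\<lambda>z. g z - h z)"
  using in_L2_add[OF assms(1) in_L2_scaleR[OF assms(2), of "-1"]] by simp

lemma in_L2_sum: "(\<And>i. i \<in> I \<Longrightarrow> in_L2 S (g i)) \<Longrightarrow> in_L2 S (\<lambda>z. \<Sum>i\<in>I. g i z)"
  by (induction I rule: infinite_finite_induct)
    (auto simp: in_L2_add, auto simp: in_L2_def L2_normsq_def)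

text \<open>Here the scalar factor varies and the vector is fixed, the reverse of
  \<open>in_L2_scaleR\<close>. Partial sums in the basis are built from such terms.\<close>

lemma in_L2_scaleR_const:
  fixes x :: "'b::euclidean_space"
  assumes "in_L2 S h"
  shows "in_L2 S (\<lambda>z. h z *\<^sub>R x)"
proof -
  have "L2_normsq S (\<lambda>z. h z *\<^sub>R x) = L2_normsq S (\<lambda>z. norm x *\<^sub>R h z)"
    unfolding L2_normsq_def by (simp add: mult.commute abs_mult)
  then show ?thesis
    using in_L2_scaleR[OF assms, of "norm x"] assms unfolding in_L2_def by auto
qed

section \<open>Parseval's identity\<close>

lemma basis_in_L2: "L2_orthonormal_basis \<mu> \<Psi> \<Longrightarrow> in_L2 \<mu> (\<Psi> i)"
  and basis_bracket:
    "L2_orthonormal_basis \<mu> \<Psi> \<Longrightarrow> bracket \<mu> (\<Psi> i) (\<Psi> j) = (if i = j then 1 else 0)"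
  unfolding L2_orthonormal_basis_def by auto

text \<open>Pairing with a fixed vector is bounded linear and so commutes with the Bochner integral.
  This lets Parseval pass from scalar to vector values.\<close>

lemma bracket_inner:
  assumes "in_L2 \<mu> g" "in_L2 \<mu> h"
  shows "bracket \<mu> g h \<bullet> x = bracket \<mu> (\<lambda>y. g y \<bullet> x) h"
  unfolding bracket_def
  using in_L2_scaleR_integrable[OF assms] by (simp flip: integral_inner_left)

lemma bracket_diff:
  assumes "in_L2 \<mu> g" "in_L2 \<mu> g'" "in_L2 \<mu> h"
  shows "bracket \<mu> (\<lambda>y. g y - g' y) h = bracket \<mu> g h - bracket \<mu> g' h"
  unfolding bracket_def
  using in_L2_scaleR_integrable[OF assms(1,3)] in_L2_scaleR_integrable[OF assms(2,3)]
  by (simp add: scaleR_diff_right)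

lemma bracket_basis_sum:
  assumes B: "L2_orthonormal_basis \<mu> \<Psi>" and "finite I"
  shows "bracket \<mu> (\<lambda>y. \<Sum>i\<in>I. \<Psi> i y *\<^sub>R d i) (\<Psi> j) = (if j \<in> I then d j else 0)"
proof -
  have int: "integrable \<mu> (\<lambda>y. (\<Psi> i y * \<Psi> j y) *\<^sub>R d i)" for i
    using in_L2_scaleR_integrable[OF in_L2_scaleR_const[OF basis_in_L2[OF B]] basis_in_L2[OF B], of j i "d i"]
    by (simp add: mult.commute)
  have int2: "integrable \<mu> (\<lambda>y. \<Psi> i y * \<Psi> j y)" for i
    using in_L2_inner_integrable[OF basis_in_L2[OF B] basis_in_L2[OF B], of i j] by simp
  have "bracket \<mu> (\<lambda>y. \<Sum>i\<in>I. \<Psi> i y *\<^sub>R d i) (\<Psi> j)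
      = (LINT y|\<mu>. (\<Sum>i\<in>I. (\<Psi> i y * \<Psi> j y) *\<^sub>R d i))"
    unfolding bracket_def by (simp add: scaleR_sum_right mult.commute)
  also have "\<dots> = (\<Sum>i\<in>I. (LINT y|\<mu>. (\<Psi> i y * \<Psi> j y) *\<^sub>R d i))"
    by (rule Bochner_Integration.integral_sum[OF int])
  also have "\<dots> = (\<Sum>i\<in>I. (LINT y|\<mu>. \<Psi> i y * \<Psi> j y) *\<^sub>R d i)"
    using int2 by simp
  also have "\<dots> = (\<Sum>i\<in>I. (if i = j then d i else 0))"
    using basis_bracket[OF B] unfolding bracket_def
    by (intro sum.cong) (auto simp: mult.commute)
  also have "\<dots> = (if j \<in> I then d j else 0)"
    using \<open>finite I\<close> by simp
  finally show ?thesis .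
qed

text \<open>With \<open>c i\<close> the bracket of \<open>g\<close> and \<open>\<Psi> i\<close>,
  expand the square, use orthonormality and complete the square in \<open>c i - d i\<close>. Both
  sides are sums because subtraction in \<open>ennreal\<close> truncates. The choice
  \<open>d = c\<close> gives Bessel's inequality, an arbitrary \<open>d\<close> the best
  approximation property.\<close>

lemma L2_normsq_basis_residual:
  fixes g :: "'y \<Rightarrow> 'b::euclidean_space"
  assumes B: "L2_orthonormal_basis \<mu> \<Psi>" and g: "in_L2 \<mu> g"
  shows "L2_normsq \<mu> (\<lambda>y. g y - (\<Sum>i<n. \<Psi> i y *\<^sub>R d i))
           + (\<Sum>i<n. ennreal ((norm (bracket \<mu> g (\<Psi> i)))\<^sup>2))
       = L2_normsq \<mu> g + (\<Sum>i<n. ennreal ((norm (bracket \<mu> g (\<Psi> i) - d i))\<^sup>2))"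
proof -
  let ?s = "\<lambda>y. \<Sum>i<n. \<Psi> i y *\<^sub>R d i" and ?c = "\<lambda>i. bracket \<mu> g (\<Psi> i)"
  note P = basis_in_L2[OF B]
  have s: "in_L2 \<mu> ?s" by (intro in_L2_sum in_L2_scaleR_const P)
  \<comment> \<open>Stated for arbitrary \<open>k\<close>, since it serves for the cross term
    (\<open>k = g\<close>) and for the square of the partial sum (\<open>k = ?s\<close>).\<close>
  have inner_s: "(LINT y|\<mu>. k y \<bullet> ?s y) = (\<Sum>i<n. bracket \<mu> k (\<Psi> i) \<bullet> d i)"
    if k: "in_L2 \<mu> k" for k :: "'y \<Rightarrow> 'b"
  proof -
    have "integrable \<mu> (\<lambda>y. \<Psi> i y *\<^sub>R k y)" for i
      by (rule in_L2_scaleR_integrable[OF k P])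
    then have "(\<Sum>i<n. bracket \<mu> k (\<Psi> i) \<bullet> d i) = (LINT y|\<mu>. (\<Sum>i<n. (\<Psi> i y *\<^sub>R k y) \<bullet> d i))"
      unfolding bracket_def
      by (subst Bochner_Integration.integral_sum) (auto simp flip: integral_inner_left simp del: inner_scaleR_left)
    also have "\<dots> = (LINT y|\<mu>. k y \<bullet> ?s y)"
      by (simp add: inner_sum_right)
    finally show ?thesis ..
  qed
  have 1: "(LINT y|\<mu>. g y \<bullet> ?s y) = (\<Sum>i<n. ?c i \<bullet> d i)"
    by (rule inner_s[OF g])
  have 2: "(LINT y|\<mu>. ?s y \<bullet> ?s y) = (\<Sum>i<n. d i \<bullet> d i)"
    unfolding inner_s[OF s] by (intro sum.cong) (auto simp: bracket_basis_sum[OF B])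
  note ints = in_L2_inner_integrable[OF g g] in_L2_inner_integrable[OF g s]
    in_L2_inner_integrable[OF s s]
  have "(LINT y|\<mu>. (norm (g y - ?s y))\<^sup>2)
      = (LINT y|\<mu>. g y \<bullet> g y - 2 * (g y \<bullet> ?s y) + ?s y \<bullet> ?s y)"
  proof (intro Bochner_Integration.integral_cong refl)
    fix y
    have "(norm (a - b))\<^sup>2 = a \<bullet> a - 2 * (a \<bullet> b) + b \<bullet> b" for a b :: 'b
      by (simp add: power2_norm_eq_inner inner_diff_left inner_diff_right inner_commute)
    then show "(norm (g y - ?s y))\<^sup>2 = g y \<bullet> g y - 2 * (g y \<bullet> ?s y) + ?s y \<bullet> ?s y" .
  qed
  also have "\<dots> = (LINT y|\<mu>. g y \<bullet> g y) - 2 * (\<Sum>i<n. ?c i \<bullet> d i) + (\<Sum>i<n. d i \<bullet> d i)"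
    using ints 1 2 by simp
  finally have "(LINT y|\<mu>. (norm (g y - ?s y))\<^sup>2) + (\<Sum>i<n. (norm (?c i))\<^sup>2)
      = (LINT y|\<mu>. (norm (g y))\<^sup>2) + (\<Sum>i<n. (norm (?c i - d i))\<^sup>2)"
    by (simp add: power2_norm_eq_inner inner_diff_left inner_diff_right inner_commute
        sum.distrib sum_subtractf sum_distrib_left algebra_simps)
  then show ?thesis
    unfolding L2_normsq_conv_integral(2)[OF g] L2_normsq_conv_integral(2)[OF in_L2_minus[OF g s]]
    by (simp add: ennreal_plus[symmetric] sum_nonneg del: ennreal_plus)
qed

text \<open>One inequality is Bessel's, the other is completeness combined with best approximation.
  The scalar case comes first because \<open>L2_orthonormal_basis\<close> expresses completeness for
  real valued functions.\<close>

lemma Parseval_real: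
  fixes g :: "'y \<Rightarrow> real"
  assumes B: "L2_orthonormal_basis \<mu> \<Psi>" and g: "in_L2 \<mu> g"
  shows "L2_normsq \<mu> g = (\<Sum>i. ennreal ((norm (bracket \<mu> g (\<Psi> i)))\<^sup>2))"
proof (rule antisym)
  let ?c = "\<lambda>i. ennreal ((norm (bracket \<mu> g (\<Psi> i)))\<^sup>2)"
  show "(\<Sum>i. ?c i) \<le> L2_normsq \<mu> g"
  proof (rule suminf_le_const)
    fix n
    show "(\<Sum>i<n. ?c i) \<le> L2_normsq \<mu> g"
      using L2_normsq_basis_residual[OF B g, of "\<lambda>i. bracket \<mu> g (\<Psi> i)" n]
      by (metis (no_types, lifting) add.right_neutral diff_self ennreal_0 le_iff_add
          add.commute norm_zero sum.neutral zero_power2)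
  qed simp
  show "L2_normsq \<mu> g \<le> (\<Sum>i. ?c i)"
  proof (rule ennreal_le_epsilon)
    fix e :: real assume "0 < e"
    then obtain n c where nc: "L2_normsq \<mu> (\<lambda>y. g y - (\<Sum>i<n. c i * \<Psi> i y)) < ennreal e"
      using B g unfolding L2_orthonormal_basis_def by blast
    \<comment> \<open>The approximant from completeness has arbitrary coefficients \<open>c\<close>;
      replacing them by the brackets only lowers the error, which is the nonnegative sum on the
      right of the identity.\<close>
    have "L2_normsq \<mu> g \<le> L2_normsq \<mu> (\<lambda>y. g y - (\<Sum>i<n. \<Psi> i y *\<^sub>R c i)) + (\<Sum>i<n. ?c i)"
      unfolding L2_normsq_basis_residual[OF B g] by simp
    also have "\<dots> \<le> ennreal e + (\<Sum>i. ?c i)"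
      using nc by (intro add_mono sum_le_suminf) (auto simp: mult.commute)
    finally show "L2_normsq \<mu> g \<le> (\<Sum>i. ?c i) + ennreal e"
      by (simp add: add.commute)
  qed
qed

lemma norm_sq_Basis: "(norm (x :: 'b::euclidean_space))\<^sup>2 = (\<Sum>b\<in>Basis. (norm (x \<bullet> b))\<^sup>2)"
  unfolding power2_norm_eq_inner using euclidean_inner[of x x] by (simp add: power2_eq_square)

text \<open>Apply the scalar identity to each coordinate and interchange the finite sum over
  \<open>Basis\<close> with the series.\<close>

lemma Parseval:
  fixes g :: "'y \<Rightarrow> 'b::euclidean_space"
  assumes B: "L2_orthonormal_basis \<mu> \<Psi>" and g: "in_L2 \<mu> g"
  shows "L2_normsq \<mu> g = (\<Sum>i. ennreal ((norm (bracket \<mu> g (\<Psi> i)))\<^sup>2))"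
proof -
  have [measurable]: "g \<in> borel_measurable \<mu>" using g by (simp add: in_L2_def)
  have *: "in_L2 \<mu> (\<lambda>y. g y \<bullet> b)" if "b \<in> Basis" for b
  proof -
    have "L2_normsq \<mu> (\<lambda>y. g y \<bullet> b) \<le> L2_normsq \<mu> g"
      unfolding L2_normsq_def using that
      by (intro nn_integral_mono ennreal_leI power_mono) (auto simp: norm_nth_le Basis_le_norm)
    with g show ?thesis unfolding in_L2_def by (auto intro: le_less_trans)
  qed
  have "L2_normsq \<mu> g = (\<integral>\<^sup>+y. (\<Sum>b\<in>Basis. ennreal ((norm (g y \<bullet> b))\<^sup>2)) \<partial>\<mu>)"
    unfolding L2_normsq_def by (subst norm_sq_Basis) simp
  also have "\<dots> = (\<Sum>b\<in>Basis. L2_normsq \<mu> (\<lambda>y. g y \<bullet> b))"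
    unfolding L2_normsq_def by (rule nn_integral_sum) simp
  also have "\<dots> = (\<Sum>b\<in>Basis. \<Sum>i. ennreal ((norm (bracket \<mu> (\<lambda>y. g y \<bullet> b) (\<Psi> i)))\<^sup>2))"
    by (intro sum.cong refl Parseval_real[OF B] *)
  also have "\<dots> = (\<Sum>i. \<Sum>b\<in>Basis. ennreal ((norm (bracket \<mu> (\<lambda>y. g y \<bullet> b) (\<Psi> i)))\<^sup>2))"
    by (rule suminf_sum[symmetric]) simp
  also have "\<dots> = (\<Sum>i. ennreal ((norm (bracket \<mu> g (\<Psi> i)))\<^sup>2))"
    unfolding bracket_inner[OF g basis_in_L2[OF B], symmetric]
    by (subst (2) norm_sq_Basis) simp
  finally show ?thesis .
qed

section \<open>Orthogonal expansion of functions of two variables\<close>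

text \<open>Tonelli's theorem: the iterated norm may be computed by integrating over
  \<open>y\<close> first, so that Parseval can be used at each fixed \<open>z\<close>.\<close>

lemma L2_L2_swap:
  fixes G :: "'y \<Rightarrow> 'z \<Rightarrow> 'b::euclidean_space"
  assumes "sigma_finite_measure \<mu>" "sigma_finite_measure S"
    and [measurable]: "(\<lambda>(y, z). G y z) \<in> borel_measurable (\<mu> \<Otimes>\<^sub>M S)"
  shows "L2_L2_normsq \<mu> S G = (\<integral>\<^sup>+z. L2_normsq \<mu> (\<lambda>y. G y z) \<partial>S)"
    and "(\<lambda>z. L2_normsq \<mu> (\<lambda>y. G y z)) \<in> borel_measurable S"
    and "\<And>z. z \<in> space S \<Longrightarrow> (\<lambda>y. G y z) \<in> borel_measurable \<mu>"
proof -
  interpret pair_sigma_finite \<mu> S using assms(1,2) by (simp add: pair_sigma_finite_def)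
  show "L2_L2_normsq \<mu> S G = (\<integral>\<^sup>+z. L2_normsq \<mu> (\<lambda>y. G y z) \<partial>S)"
    unfolding L2_L2_normsq_def L2_normsq_def
    by (rule Fubini'[symmetric]) measurable
  show "(\<lambda>z. L2_normsq \<mu> (\<lambda>y. G y z)) \<in> borel_measurable S"
    unfolding L2_normsq_def by measurable
  show "(\<lambda>y. G y z) \<in> borel_measurable \<mu>" if "z \<in> space S" for z
    using that by measurable
qed

text \<open>A nonnegative function with finite integral is finite almost everywhere; here the
  function is the squared norm of the section.\<close>

lemma in_L2_L2_AE_section:
  assumes \<sigma>: "sigma_finite_measure \<mu>" "sigma_finite_measure S" and G: "in_L2_L2 \<mu> S G"
  shows "AE z in S. in_L2 \<mu> (\<lambda>y. G y z)"
proof -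
  have m: "(\<lambda>(y, z). G y z) \<in> borel_measurable (\<mu> \<Otimes>\<^sub>M S)"
    and "L2_L2_normsq \<mu> S G < \<infinity>" using G by (auto simp: in_L2_L2_def)
  then have "AE z in S. L2_normsq \<mu> (\<lambda>y. G y z) \<noteq> \<infinity>"
    using L2_L2_swap[OF \<sigma> m] by (intro nn_integral_PInf_AE) auto
  then show ?thesis
    by (rule AE_mp) (use L2_L2_swap(3)[OF \<sigma> m] in \<open>auto simp: in_L2_def less_top\<close>)
qed

lemma bracket_measurable:
  assumes \<sigma>: "sigma_finite_measure \<mu>"
    and m[measurable]: "(\<lambda>(y, z). G y z) \<in> borel_measurable (\<mu> \<Otimes>\<^sub>M S)"
    and [measurable]: "h \<in> borel_measurable \<mu>"
  shows "(\<lambda>z. bracket \<mu> (\<lambda>y. G y z) h) \<in> borel_measurable S"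
proof -
  interpret sigma_finite_measure \<mu> by (rule \<sigma>)
  show ?thesis unfolding bracket_def by measurable
qed

text \<open>Integrate over \<open>z\<close> Parseval's identity for the sections, and
  \<open>L2_normsq_basis_residual\<close> with \<open>d\<close> equal to the brackets. The
  coefficients \<open>c\<close> are prescribed only almost everywhere, as the residual coefficients
  are known to be brackets only off a null set.\<close>

lemma L2_L2_normsq_expansion:
  fixes G :: "'y \<Rightarrow> 'z \<Rightarrow> 'b::euclidean_space"
  assumes \<sigma>: "sigma_finite_measure \<mu>" "sigma_finite_measure S" and G: "in_L2_L2 \<mu> S G"
    and B: "L2_orthonormal_basis \<mu> \<Psi>"
    and c: "AE z in S. \<forall>j. c j z = bracket \<mu> (\<lambda>y. G y z) (\<Psi> j)"
    and [measurable]: "\<And>j. c j \<in> borel_measurable S"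
  shows "L2_L2_normsq \<mu> S G = (\<Sum>j. L2_normsq S (c j))"
    and "L2_L2_normsq \<mu> S (\<lambda>y z. G y z - (\<Sum>j<n. \<Psi> j y *\<^sub>R c j z)) + (\<Sum>j<n. L2_normsq S (c j))
           = L2_L2_normsq \<mu> S G"
proof -
  have m[measurable]: "(\<lambda>(y, z). G y z) \<in> borel_measurable (\<mu> \<Otimes>\<^sub>M S)"
    using G by (auto simp: in_L2_L2_def)
  have [measurable]: "\<Psi> j \<in> borel_measurable \<mu>" for j
    using basis_in_L2[OF B] by (simp add: in_L2_def)
  note ae = in_L2_L2_AE_section[OF \<sigma> G]
  have "L2_L2_normsq \<mu> S G = (\<integral>\<^sup>+z. (\<Sum>j. ennreal ((norm (c j z))\<^sup>2)) \<partial>S)"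
    unfolding L2_L2_swap(1)[OF \<sigma> m]
    by (rule nn_integral_cong_AE) (use ae c in \<open>eventually_elim, simp add: Parseval[OF B]\<close>)
  also have "\<dots> = (\<Sum>j. L2_normsq S (c j))"
    unfolding L2_normsq_def by (rule nn_integral_suminf) simp
  finally show "L2_L2_normsq \<mu> S G = (\<Sum>j. L2_normsq S (c j))" .
  let ?D = "\<lambda>y z. G y z - (\<Sum>j<n. \<Psi> j y *\<^sub>R c j z)"
  have mD: "(\<lambda>(y, z). ?D y z) \<in> borel_measurable (\<mu> \<Otimes>\<^sub>M S)"
    using m by (simp add: case_prod_unfold)
  have "L2_L2_normsq \<mu> S ?D + (\<Sum>j<n. L2_normsq S (c j))
      = (\<integral>\<^sup>+z. L2_normsq \<mu> (\<lambda>y. ?D y z) + (\<Sum>j<n. ennreal ((norm (c j z))\<^sup>2)) \<partial>S)"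
    unfolding L2_L2_swap(1)[OF \<sigma> mD] L2_normsq_def[of S]
    using L2_L2_swap(2)[OF \<sigma> mD] by (simp add: nn_integral_add nn_integral_sum del: sum_ennreal)
  also have "\<dots> = (\<integral>\<^sup>+z. L2_normsq \<mu> (\<lambda>y. G y z) \<partial>S)"
    by (rule nn_integral_cong_AE)
      (use ae c in \<open>eventually_elim, simp add: L2_normsq_basis_residual[OF B] del: sum_ennreal\<close>)
  finally show "L2_L2_normsq \<mu> S ?D + (\<Sum>j<n. L2_normsq S (c j)) = L2_L2_normsq \<mu> S G"
    unfolding L2_L2_swap(1)[OF \<sigma> m] .
qed

text \<open>The squared error is the total norm minus a partial sum of the coefficient norms, and
  these partial sums converge to the total. Finiteness of the total makes the \<open>ennreal\<close>
  subtraction continuous and its limit zero.\<close>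

lemma L2_L2_expansion_tendsto:
  fixes G :: "'y \<Rightarrow> 'z \<Rightarrow> 'b::euclidean_space"
  assumes \<sigma>: "sigma_finite_measure \<mu>" "sigma_finite_measure S" and G: "in_L2_L2 \<mu> S G"
    and B: "L2_orthonormal_basis \<mu> \<Psi>"
    and c: "AE z in S. \<forall>j. c j z = bracket \<mu> (\<lambda>y. G y z) (\<Psi> j)"
    and m: "\<And>j. c j \<in> borel_measurable S"
  shows "(\<lambda>n. L2_L2_normsq \<mu> S (\<lambda>y z. G y z - (\<Sum>j<n. \<Psi> j y *\<^sub>R c j z))) \<longlonglongrightarrow> 0"
proof -
  let ?s = "\<lambda>n. \<Sum>j<n. L2_normsq S (c j)"
  have fin: "L2_L2_normsq \<mu> S G < \<infinity>" using G by (simp add: in_L2_L2_def)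
  have le: "?s n \<le> L2_L2_normsq \<mu> S G" for n
    unfolding L2_L2_normsq_expansion(1)[OF assms] by (rule sum_le_suminf) auto
  have "L2_L2_normsq \<mu> S (\<lambda>y z. G y z - (\<Sum>j<n. \<Psi> j y *\<^sub>R c j z)) = L2_L2_normsq \<mu> S G - ?s n" for n
  proof -
    have "?s n \<noteq> \<top>" using le_less_trans[OF le[of n] fin] by (simp only: infinity_ennreal_def less_top)
    then show ?thesis
      unfolding L2_L2_normsq_expansion(2)[OF assms, of n, symmetric] by simp
  qed
  moreover have "?s \<longlonglongrightarrow> L2_L2_normsq \<mu> S G"
    unfolding L2_L2_normsq_expansion(1)[OF assms] by (rule summable_LIMSEQ) simp
  then have "(\<lambda>n. L2_L2_normsq \<mu> S G - ?s n) \<longlonglongrightarrow> L2_L2_normsq \<mu> S G - L2_L2_normsq \<mu> S G"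
    using fin by (intro tendsto_diff_ennreal_general) auto
  ultimately show ?thesis using fin by simp
qed

lemma in_L2_L2_product:
  assumes \<sigma>: "sigma_finite_measure S" and h: "in_L2 \<mu> h" and c: "in_L2 S c"
  shows "in_L2_L2 \<mu> S (\<lambda>y z. h y *\<^sub>R c z)"
proof -
  have [measurable]: "h \<in> borel_measurable \<mu>" "c \<in> borel_measurable S"
    using h c by (auto simp: in_L2_def)
  have "L2_L2_normsq \<mu> S (\<lambda>y z. h y *\<^sub>R c z) = L2_normsq \<mu> h * L2_normsq S c"
    unfolding L2_L2_normsq_def L2_normsq_scaleR[OF \<open>c \<in> borel_measurable S\<close>]
    by (subst nn_integral_multc) (auto simp: L2_normsq_def)
  then show ?thesis
    using h c by (auto simp: in_L2_L2_def in_L2_def ennreal_mult_less_top case_prod_unfold)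
qed

text \<open>The integral over \<open>z\<close> is constant in \<open>y\<close> and factors out;
  orthogonality of the terms of the series is thereby reduced to that of the basis.\<close>

lemma L2_L2_inner_product:
  "L2_L2_inner \<mu> S (\<lambda>y z. h y *\<^sub>R c z) (\<lambda>y z. h' y *\<^sub>R c' z)
     = bracket \<mu> h h' * (LINT z|S. c z \<bullet> c' z)"
proof -
  have "L2_L2_inner \<mu> S (\<lambda>y z. h y *\<^sub>R c z) (\<lambda>y z. h' y *\<^sub>R c' z)
      = (LINT y|\<mu>. (h' y * h y) * (LINT z|S. c z \<bullet> c' z))"
    unfolding L2_L2_inner_def by (simp add: mult.assoc[symmetric] mult.commute[of "h' _"])
  then show ?thesis unfolding bracket_def by simp
qed

section \<open>The space-time slab\<close>

text \<open>A countable cover by sets of finite measure keeps its properties, because the completion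
  extends the measure.\<close>

lemma sigma_finite_completion:
  assumes "sigma_finite_measure M"
  shows "sigma_finite_measure (completion M)"
proof -
  interpret sigma_finite_measure M by fact
  from sigma_finite_countable obtain C
    where "countable C" "C \<subseteq> sets M" "\<Union>C = space M" "\<forall>a\<in>C. emeasure M a \<noteq> \<infinity>"
    by blast
  then show ?thesis
    by (intro sigma_finite_measure.intro exI[of _ C]) (auto simp: subset_iff)
qed

lemma sigma_finite_slab: "sigma_finite_measure (slab t)"
  unfolding slab_def
  by (intro sigma_finite_measure_restrict_space sigma_finite_completion lborel.sigma_finite_measure_axioms)
    (simp add: borel_open open_Times)

lemma AE_slab_iff: "(AE z in slab t. Q z) \<longleftrightarrow> (AE z in lebesgue. z \<in> {0<..<t} \<times> UNIV \<longrightarrow> Q z)"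
  unfolding slab_def by (rule AE_restrict_space_iff) (simp add: borel_open open_Times)

lemma AE_slab_mono: "t \<le> T \<Longrightarrow> AE z in slab T. Q z \<Longrightarrow> AE z in slab t. Q z"
  unfolding AE_slab_iff by (erule AE_mp) auto

lemma ident_measurable_slab: "t \<le> T \<Longrightarrow> (\<lambda>z. z) \<in> slab t \<rightarrow>\<^sub>M slab T"
  unfolding slab_def by (rule measurable_restrict_space3) auto

text \<open>The exceptional times form a null set \<open>N\<close>, and the cylinder
  \<open>N \<times> UNIV\<close> is null in the plane. The argument passes through
  \<open>lborel\<close>, where the product structure is available, and returns to the
  completion.\<close>

lemma AE_slab_fst:
  assumes "AE t in lebesgue_on {0<..<T}. Q t"
  shows "AE z in slab T. Q (fst z)"
proof -
  have "AE t in lborel. t \<in> {0<..<T} \<longrightarrow> Q t"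
    using assms by (subst (asm) AE_restrict_space_iff) (auto simp: AE_completion_iff)
  then obtain N where N: "{t. \<not> (t \<in> {0<..<T} \<longrightarrow> Q t)} \<subseteq> N" "N \<in> null_sets lborel"
    by (auto simp: eventually_ae_filter)
  have "N \<times> (UNIV :: real set) \<in> null_sets (lborel \<Otimes>\<^sub>M lborel)"
    using N(2) by (intro lborel.times_in_null_sets1) auto
  then have "AE z in lborel. z \<notin> N \<times> (UNIV :: real set)"
    unfolding lborel_prod by (rule AE_not_in)
  then have "AE z in lebesgue. z \<notin> N \<times> (UNIV :: real set)"
    by (rule AE_completion)
  then show ?thesis
    unfolding AE_slab_iff by (rule AE_mp) (use N(1) in \<open>auto intro!: AE_I2\<close>)
qed

text \<open>The preimages under \<open>f\<close> and \<open>g\<close> differ by a subset of a null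
  set, which is measurable by completeness.\<close>

lemma (in complete_measure) borel_measurable_AE_eq:
  assumes f: "f \<in> borel_measurable M" and eq: "AE x in M. f x = g x"
  shows "g \<in> borel_measurable M"
proof (rule measurableI)
  fix A :: "'b set" assume "A \<in> sets borel"
  then have "f -` A \<inter> space M \<in> sets M" by (rule measurable_sets[OF f])
  then show "g -` A \<inter> space M \<in> sets M"
  proof (rule in_sets_AE[rotated])
    show "AE x in M. x \<in> f -` A \<inter> space M \<longleftrightarrow> x \<in> g -` A \<inter> space M"
      using eq by eventually_elim auto
  qed simp
qed simp

text \<open>Extension by zero moves the question to \<open>lebesgue\<close> on the whole plane,
  which is complete. The lemma supplies measurability of the residual coefficients, which are
  defined through pointwise derivatives.\<close>

lemma borel_measurable_slab_AE:
  fixes f g :: "real \<times> real \<Rightarrow> 'b::euclidean_space"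
  assumes f: "f \<in> borel_measurable (slab t)" and eq: "AE z in slab t. f z = g z"
  shows "g \<in> borel_measurable (slab t)"
proof -
  let ?A = "{0<..<t} \<times> (UNIV :: real set)"
  have A: "?A \<in> sets lebesgue" by (simp add: borel_open open_Times)
  have "(\<lambda>z. if z \<in> ?A then f z else 0) \<in> borel_measurable lebesgue"
    using f A unfolding slab_def by (intro borel_measurable_if_I)
  moreover have "AE z in lebesgue. (if z \<in> ?A then f z else 0) = (if z \<in> ?A then g z else 0)"
    using eq unfolding AE_slab_iff by eventually_elim auto
  ultimately have "(\<lambda>z. if z \<in> ?A then g z else 0) \<in> borel_measurable lebesgue"
    by (rule completion.borel_measurable_AE_eq)
  then show ?thesis
    unfolding slab_def by (rule borel_measurable_if_D)
qed

lemma in_L2_L2_slab_mono: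
  assumes "t \<le> T" and G: "in_L2_L2 \<mu> (slab T) G"
  shows "in_L2_L2 \<mu> (slab t) G"
proof -
  have m: "(\<lambda>(y, z). G y z) \<in> borel_measurable (\<mu> \<Otimes>\<^sub>M slab T)"
    using G by (simp add: in_L2_L2_def)
  have [measurable]: "(\<lambda>z. z) \<in> slab t \<rightarrow>\<^sub>M slab T"
    by (rule ident_measurable_slab[OF assms(1)])
  have "(\<lambda>x. (fst x, (\<lambda>z. z) (snd x))) \<in> \<mu> \<Otimes>\<^sub>M slab t \<rightarrow>\<^sub>M \<mu> \<Otimes>\<^sub>M slab T"
    by measurable
  from measurable_compose[OF this m]
  have "(\<lambda>(y, z). G y z) \<in> borel_measurable (\<mu> \<Otimes>\<^sub>M slab t)"
    by (simp add: case_prod_unfold)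
  moreover have "L2_normsq (slab t) g \<le> L2_normsq (slab T) g" for g :: "real \<times> real \<Rightarrow> 'b"
  proof -
    \<comment> \<open>Writing both norms as integrals over the whole plane reduces monotonicity to
      that of the indicators.\<close>
    have "?thesis \<longleftrightarrow> (\<integral>\<^sup>+z. ennreal ((norm (g z))\<^sup>2) * indicator ({0<..<t} \<times> UNIV) z \<partial>lebesgue)
        \<le> (\<integral>\<^sup>+z. ennreal ((norm (g z))\<^sup>2) * indicator ({0<..<T} \<times> UNIV) z \<partial>lebesgue)"
      unfolding L2_normsq_def slab_def
      by (subst (1 2) nn_integral_restrict_space) (auto simp: borel_open open_Times)
    also have "\<dots>"
      using assms(1) by (intro nn_integral_mono) (auto split: split_indicator)
    finally show ?thesis .
  qed
  then have "L2_L2_normsq \<mu> (slab t) G \<le> L2_L2_normsq \<mu> (slab T) G"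
    unfolding L2_L2_normsq_def by (intro nn_integral_mono)
  ultimately show ?thesis
    using G by (auto simp: in_L2_L2_def intro: le_less_trans)
qed

lemma borel_measurable_slab_mono:
  assumes "t \<le> T" and g: "g \<in> borel_measurable (slab T)"
  shows "g \<in> borel_measurable (slab t)"
  using measurable_compose[OF ident_measurable_slab[OF assms(1)] g] by simp

section \<open>Residuals\<close>

text \<open>In \<open>W1_inf\<close> the exceptional times are the same for all \<open>x\<close>, so
  the exceptional set in the slab is a null cylinder.\<close>

lemma W1_inf_AE_differentiable:
  assumes "u \<in> W1_inf T X"
  shows "AE (t, x) in slab T. (\<lambda>s. u s x) differentiable at t"
proof -
  have "AE t in lebesgue_on {0<..<T}. \<exists>v\<in>X. \<forall>x. ((\<lambda>s. u s x) has_vector_derivative v x) (at t)"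
    using assms by (simp add: W1_inf_def)
  from AE_slab_fst[OF this] show ?thesis
  proof eventually_elim
    case (elim z)
    then obtain v where "((\<lambda>s. u s (snd z)) has_vector_derivative v (snd z)) (at (fst z))"
      by blast
    then show ?case
      by (auto simp: case_prod_unfold intro: differentiableI_vector)
  qed
qed

text \<open>\<open>vector_derivative\<close> is linear only where the derivatives exist, hence the
  differentiability hypothesis. The second conclusion allows iteration: from the reconstructions to
  the modes, and from the modes to \<open>usts\<close>.\<close>

lemma
  fixes c :: "'i \<Rightarrow> real" and u :: "'i \<Rightarrow> real \<Rightarrow> real \<Rightarrow> 'b::real_normed_vector"
  assumes "\<And>i. i \<in> I \<Longrightarrow> (\<lambda>s. u i s x) differentiable at t"
    and v: "v = (\<lambda>t x. \<Sum>i\<in>I. c i *\<^sub>R u i t x)"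
  shows d_t_sum: "d_t v (t, x) = (\<Sum>i\<in>I. c i *\<^sub>R d_t (u i) (t, x))"
    and differentiable_sum_scaleR: "(\<lambda>s. v s x) differentiable at t"
proof -
  have "((\<lambda>s. \<Sum>i\<in>I. c i *\<^sub>R u i s x) has_vector_derivative
      (\<Sum>i\<in>I. c i *\<^sub>R vector_derivative (\<lambda>s. u i s x) (at t))) (at t)"
    using assms(1)
    by (intro has_vector_derivative_sum bounded_linear.has_vector_derivative[OF bounded_linear_scaleR_right])
      (auto simp: vector_derivative_works)
  then show "d_t v (t, x) = (\<Sum>i\<in>I. c i *\<^sub>R d_t (u i) (t, x))"
    "(\<lambda>s. v s x) differentiable at t"
    by (auto simp: d_t_def v intro: vector_derivative_at differentiableI_vector)
qed

theorem lemma4p2: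
  fixes P :: "'p measure" and \<xi> :: "'p \<Rightarrow> real"
    and \<Xi> :: "real set" and w :: "real \<Rightarrow> real" and \<mu> :: "real measure"
    and \<Psi> :: "nat \<Rightarrow> real \<Rightarrow> real"
    and T :: real and U :: "(real^'m) set" and f :: "real^'m \<Rightarrow> real^'m"
    and M R p :: nat and a h :: real
    and yq wq :: "nat \<Rightarrow> real"
    and ust :: "real \<Rightarrow> real \<Rightarrow> real \<Rightarrow> real^'m"
    and umode :: "nat \<Rightarrow> real \<Rightarrow> real \<Rightarrow> real^'m"
    and usts :: "real \<Rightarrow> real \<Rightarrow> real \<Rightarrow> real^'m"
    and Rst Rsts :: "real \<Rightarrow> real \<times> real \<Rightarrow> real^'m"
    and Rdet Rsq Rsc :: "nat \<Rightarrow> real \<times> real \<Rightarrow> real^'m"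
    and S :: "nat \<Rightarrow> real \<Rightarrow> real \<times> real \<Rightarrow> real^'m"
    and Ests Edet Esq Esc :: "real \<Rightarrow> ennreal"
  assumes "prob_space P"
    and "\<Xi> \<in> sets borel"
    and "\<And>y. y \<in> \<Xi> \<Longrightarrow> 0 \<le> w y"
    and "distributed P (restrict_space lborel \<Xi>) \<xi> (\<lambda>y. ennreal (w y))"
    and mu: "\<mu> = weighted \<Xi> w"
    and "L2_orthonormal_basis \<mu> \<Psi>"
    and "0 < T"
    and "open U" and "C2_on U f" and "strictly_hyperbolic U f"
    and "0 < h"
    and "\<And>l. l \<le> R \<Longrightarrow> yq l \<in> \<Xi>"
    and "\<And>l. l \<le> R \<Longrightarrow>
           ust (yq l) \<in> W1_inf T (dg_space a h (p + 1) \<inter> {v. continuous_on UNIV v})"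
    and "\<And>l t x. l \<le> R \<Longrightarrow> t \<in> {0<..<T} \<Longrightarrow> ust (yq l) t x \<in> U"
    and Rst: "\<And>y. Rst y = residual f (ust y)"
    and "\<And>l. l \<le> R \<Longrightarrow> in_L2 (slab T) (Rst (yq l))"
    and umode: "\<And>i t x. umode i t x = (\<Sum>l\<le>R. (\<Psi> i (yq l) * wq l) *\<^sub>R ust (yq l) t x)"
    and usts: "\<And>y t x. usts y t x = (\<Sum>i\<le>M. \<Psi> i y *\<^sub>R umode i t x)"
    and "\<And>y t x. y \<in> \<Xi> \<Longrightarrow> t \<in> {0<..<T} \<Longrightarrow> usts y t x \<in> U"
    and Rsts: "\<And>y. Rsts y = residual f (usts y)"
    and "in_L2_L2 \<mu> (slab T) Rsts"
    and Rdet: "\<And>j z. Rdet j z = (\<Sum>l\<le>R. (\<Psi> j (yq l) * wq l) *\<^sub>R Rst (yq l) z)"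
    and Rsq: "\<And>j z. Rsq j z =
           bracket \<mu> (\<lambda>y. d_x_flux f (usts y) z) (\<Psi> j)
           - (\<Sum>l\<le>R. (\<Psi> j (yq l) * wq l) *\<^sub>R d_x_flux f (ust (yq l)) z)"
    and Rsc: "\<And>j z. Rsc j z = bracket \<mu> (\<lambda>y. d_x_flux f (usts y) z) (\<Psi> j)"
    and S: "\<And>j y z. S j y z =
           (if j \<le> M then \<Psi> j y *\<^sub>R (Rdet j z + Rsq j z) else \<Psi> j y *\<^sub>R Rsc j z)"
    and Ests: "\<And>t. Ests t = L2_L2_normsq \<mu> (slab t) Rsts"
    and Edet: "\<And>t. Edet t = (\<Sum>j\<le>M. L2_normsq (slab t) (Rdet j))"
    and Esq: "\<And>t. Esq t = (\<Sum>j\<le>M. L2_normsq (slab t) (Rsq j))"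
    and Esc: "\<And>t. Esc t = (\<Sum>k. L2_normsq (slab t) (Rsc (M + 1 + k)))"
  shows
    "(\<forall>j\<le>M. in_L2 (slab T) (Rdet j) \<and> in_L2 (slab T) (Rsq j)) \<and>
     (\<forall>j>M. in_L2 (slab T) (Rsc j)) \<and>
     (\<forall>j. in_L2_L2 \<mu> (slab T) (S j)) \<and>
     (\<forall>j k. j \<noteq> k \<longrightarrow> L2_L2_inner \<mu> (slab T) (S j) (S k) = 0) \<and>
     ((\<lambda>N. L2_L2_normsq \<mu> (slab T)
              (\<lambda>y z. Rsts y z - ((\<Sum>j\<le>M. \<Psi> j y *\<^sub>R (Rdet j z + Rsq j z))
                                + (\<Sum>j\<in>{M<..N}. \<Psi> j y *\<^sub>R Rsc j z)))) \<longlonglongrightarrow> 0) \<and>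
     (\<forall>t\<in>{0<..<T}.
        Ests t = (\<Sum>j\<le>M. L2_normsq (slab t) (\<lambda>z. Rdet j z + Rsq j z))
                 + (\<Sum>k. L2_normsq (slab t) (Rsc (M + 1 + k))) \<and>
        Ests t \<le> 2 * Edet t + 2 * Esq t + Esc t)"
proof -
  note basis = \<open>L2_orthonormal_basis \<mu> \<Psi>\<close> and G = \<open>in_L2_L2 \<mu> (slab T) Rsts\<close>
  note P = basis_in_L2[OF basis]
  \<comment> \<open>The law of \<open>\<xi>\<close> is \<open>\<mu>\<close>, so \<open>\<mu>\<close>
    is a probability measure and in particular sigma-finite, as Tonelli's theorem requires.\<close>
  have dm: "distr P (restrict_space lborel \<Xi>) \<xi> = \<mu>"
    using \<open>distributed P (restrict_space lborel \<Xi>) \<xi> (\<lambda>y. ennreal (w y))\<close>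
    unfolding mu weighted_def by (rule distributed_distr_eq_density)
  interpret \<mu>: prob_space \<mu>
    unfolding dm[symmetric]
    using \<open>prob_space P\<close> \<open>distributed P (restrict_space lborel \<Xi>) \<xi> (\<lambda>y. ennreal (w y))\<close>
    by (intro prob_space.prob_space_distr) (auto dest: distributed_measurable)
  have \<sigma>: "sigma_finite_measure \<mu>" by unfold_locales
  note \<sigma>s = sigma_finite_slab

  \<comment> \<open>\<open>c\<close> collects the claimed coefficients under one index,
    \<open>b\<close> holds the actual brackets of the residual.\<close>
  define c where "c j z = (if j \<le> M then Rdet j z + Rsq j z else Rsc j z)" for j z
  define b where "b j z = bracket \<mu> (\<lambda>y. Rsts y z) (\<Psi> j)" for j z
  have S_eq: "S j = (\<lambda>y z. \<Psi> j y *\<^sub>R c j z)" for j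
    by (auto simp: S c_def fun_eq_iff)

  \<comment> \<open>Identification of the basis coefficients\<close>
  have diff: "AE (t, x) in slab T. \<forall>l\<le>R. (\<lambda>s. ust (yq l) s x) differentiable at t"
  proof -
    have "AE z in slab T. \<forall>l\<in>{..R}. (\<lambda>s. ust (yq l) s (snd z)) differentiable at (fst z)"
      using W1_inf_AE_differentiable[OF \<open>\<And>l. l \<le> R \<Longrightarrow> ust (yq l) \<in> W1_inf T (dg_space a h (p + 1) \<inter> {v. continuous_on UNIV v})\<close>]
      by (intro AE_finite_allI) (auto simp: case_prod_unfold)
    then show ?thesis by (simp add: case_prod_unfold Ball_def)
  qed
  have coeff: "AE z in slab T. \<forall>j. c j z = b j z"
    using diff in_L2_L2_AE_section[OF \<sigma> \<sigma>s G]
  proof eventually_elim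
    case (elim z)
    obtain t x where z: "z = (t, x)" by (cases z)
    have d: "\<And>l. l \<in> {..R} \<Longrightarrow> (\<lambda>s. ust (yq l) s x) differentiable at t"
      using elim(1) z by auto
    have mode: "umode i = (\<lambda>t x. \<Sum>l\<le>R. (\<Psi> i (yq l) * wq l) *\<^sub>R ust (yq l) t x)" for i
      by (simp add: umode fun_eq_iff)
    have d_mode: "d_t (umode i) (t, x) = (\<Sum>l\<le>R. (\<Psi> i (yq l) * wq l) *\<^sub>R d_t (ust (yq l)) (t, x))" for i
      by (rule d_t_sum[where u = "\<lambda>l. ust (yq l)", OF d mode])
    have dsts: "d_t (usts y) z = (\<Sum>i\<le>M. \<Psi> i y *\<^sub>R d_t (umode i) z)" for y
      unfolding z
      by (rule d_t_sum[where u = umode])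
        (auto simp: usts fun_eq_iff intro: differentiable_sum_scaleR[where u = "\<lambda>l. ust (yq l)", OF d mode])
    \<comment> \<open>A difference of a square integrable section and a finite combination of basis
      functions, so the flux derivative is itself square integrable in \<open>y\<close> and its
      bracket splits.\<close>
    have flux: "(\<lambda>y. d_x_flux f (usts y) z) = (\<lambda>y. Rsts y z - (\<Sum>i\<le>M. \<Psi> i y *\<^sub>R d_t (umode i) z))"
      by (simp add: Rsts residual_def dsts fun_eq_iff)
    have "bracket \<mu> (\<lambda>y. d_x_flux f (usts y) z) (\<Psi> j)
        = b j z - (if j \<le> M then d_t (umode j) z else 0)" for j
      unfolding flux b_def
      by (subst bracket_diff) (auto simp: bracket_basis_sum[OF basis] elim(2) P intro!: in_L2_sum in_L2_scaleR_const)
    moreover have "Rdet j z = d_t (umode j) z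
        + (\<Sum>l\<le>R. (\<Psi> j (yq l) * wq l) *\<^sub>R d_x_flux f (ust (yq l)) z)" for j
      unfolding Rdet Rst residual_def z d_mode by (simp add: scaleR_add_right sum.distrib)
    \<comment> \<open>For \<open>j \<le> M\<close> the quadrature sums of flux derivatives in
      \<open>Rdet\<close> and \<open>Rsq\<close> cancel, and so do the two occurrences of
      \<open>d_t (umode j) z\<close>.\<close>
    ultimately show ?case
      by (simp add: c_def Rsq Rsc)
  qed

  \<comment> \<open>Measurability and square integrability of the coefficients\<close>
  have b_meas: "b j \<in> borel_measurable (slab T)" for j
    using bracket_measurable[OF \<sigma>, of Rsts "slab T" "\<Psi> j"] G P
    unfolding b_def[abs_def] in_L2_L2_def in_L2_def by blast
  \<comment> \<open>Measurability is inherited from the brackets, with which \<open>c j\<close>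
    agrees almost everywhere.\<close>
  have c_meas: "c j \<in> borel_measurable (slab T)" for j
    by (rule borel_measurable_slab_AE[OF b_meas[of j]]) (use coeff in \<open>eventually_elim, simp\<close>)
  have coeff_t: "AE z in slab t. \<forall>j. c j z = bracket \<mu> (\<lambda>y. Rsts y z) (\<Psi> j)" if "t \<le> T" for t
    using AE_slab_mono[OF that coeff] unfolding b_def .
  have c_meas_t: "c j \<in> borel_measurable (slab t)" if "t \<le> T" for j t
    by (rule borel_measurable_slab_mono[OF that c_meas])
  have G_t: "in_L2_L2 \<mu> (slab t) Rsts" if "t \<le> T" for t
    by (rule in_L2_L2_slab_mono[OF that G])
  have split: "(\<Sum>j. L2_normsq (slab t) (c j))
      = (\<Sum>j\<le>M. L2_normsq (slab t) (\<lambda>z. Rdet j z + Rsq j z))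
        + (\<Sum>k. L2_normsq (slab t) (Rsc (M + 1 + k)))" for t
  proof -
    have lo: "c j = (\<lambda>z. Rdet j z + Rsq j z)" if "j \<le> M" for j
      using that by (simp add: c_def fun_eq_iff)
    have hi: "c (k + Suc M) = Rsc (M + 1 + k)" for k
      by (simp add: c_def fun_eq_iff add.commute)
    have "(\<Sum>j. L2_normsq (slab t) (c j))
        = (\<Sum>j<Suc M. L2_normsq (slab t) (c j)) + (\<Sum>k. L2_normsq (slab t) (c (k + Suc M)))"
      by (subst suminf_offset[of _ "Suc M"]) (auto simp: add.commute)
    then show ?thesis
      unfolding hi lessThan_Suc_atMost by (simp add: lo)
  qed

  \<comment> \<open>A single term is bounded by the full Parseval series, which is finite.\<close>
  have c_L2: "in_L2 (slab T) (c j)" for j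
  proof -
    have "L2_normsq (slab T) (c j) = (\<Sum>i\<in>{j}. L2_normsq (slab T) (c i))" by simp
    also have "\<dots> \<le> L2_L2_normsq \<mu> (slab T) Rsts"
      unfolding L2_L2_normsq_expansion(1)[OF \<sigma> \<sigma>s G basis coeff_t[OF order_refl] c_meas]
      by (rule sum_le_suminf) auto
    finally show ?thesis
      using G c_meas by (auto simp: in_L2_def in_L2_L2_def intro: le_less_trans)
  qed
  have det_L2: "in_L2 (slab T) (Rdet j)" for j
    unfolding Rdet[abs_def]
    by (intro in_L2_sum in_L2_scaleR) (use \<open>\<And>l. l \<le> R \<Longrightarrow> in_L2 (slab T) (Rst (yq l))\<close> in auto)
  \<comment> \<open>\<open>Rsq j\<close> is obtained as \<open>c j - Rdet j\<close>, both of which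
    are already square integrable.\<close>
  have sq_L2: "in_L2 (slab T) (Rsq j)" if "j \<le> M" for j
    using in_L2_minus[OF c_L2 det_L2, of j j] that by (simp add: c_def)
  have sc_L2: "in_L2 (slab T) (Rsc j)" if "j > M" for j
    using c_L2[of j] that by (simp add: c_def[abs_def])

  \<comment> \<open>Convergence of the series\<close>
  have "(\<lambda>n. L2_L2_normsq \<mu> (slab T) (\<lambda>y z. Rsts y z - (\<Sum>j<Suc n. \<Psi> j y *\<^sub>R c j z))) \<longlonglongrightarrow> 0"
    by (rule LIMSEQ_Suc[OF L2_L2_expansion_tendsto[OF \<sigma> \<sigma>s G basis coeff_t[OF order_refl] c_meas]])
  \<comment> \<open>The shift to \<open>Suc n\<close> turns the index range into j \<le> n, matching
    \<open>{M<..N}\<close>. The splitting requires \<open>M \<le> n\<close>, so the two sequences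
    agree eventually, which suffices for the limit.\<close>
  moreover have "(\<Sum>j<Suc n. \<Psi> j y *\<^sub>R c j z)
      = (\<Sum>j\<le>M. \<Psi> j y *\<^sub>R (Rdet j z + Rsq j z)) + (\<Sum>j\<in>{M<..n}. \<Psi> j y *\<^sub>R Rsc j z)"
    if "M \<le> n" for n y z
  proof -
    have un: "{..<Suc n} = {..M} \<union> {M<..n}" using that by auto
    have "(\<Sum>j<Suc n. \<Psi> j y *\<^sub>R c j z)
        = (\<Sum>j\<le>M. \<Psi> j y *\<^sub>R c j z) + (\<Sum>j\<in>{M<..n}. \<Psi> j y *\<^sub>R c j z)"
      unfolding un by (rule sum.union_disjoint) auto
    then show ?thesis by (simp add: c_def)
  qed
  then have "\<forall>\<^sub>F n in sequentially. L2_L2_normsq \<mu> (slab T) (\<lambda>y z. Rsts y z - (\<Sum>j<Suc n. \<Psi> j y *\<^sub>R c j z))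
      = L2_L2_normsq \<mu> (slab T) (\<lambda>y z. Rsts y z - ((\<Sum>j\<le>M. \<Psi> j y *\<^sub>R (Rdet j z + Rsq j z))
         + (\<Sum>j\<in>{M<..n}. \<Psi> j y *\<^sub>R Rsc j z)))"
    by (intro eventually_sequentiallyI[of M]) (simp only:)
  ultimately have lim: "(\<lambda>N. L2_L2_normsq \<mu> (slab T)
      (\<lambda>y z. Rsts y z - ((\<Sum>j\<le>M. \<Psi> j y *\<^sub>R (Rdet j z + Rsq j z))
         + (\<Sum>j\<in>{M<..N}. \<Psi> j y *\<^sub>R Rsc j z)))) \<longlonglongrightarrow> 0"
    by (rule Lim_transform_eventually)

  \<comment> \<open>Energy identity and error bound\<close>
  have energy: "Ests t = (\<Sum>j\<le>M. L2_normsq (slab t) (\<lambda>z. Rdet j z + Rsq j z))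
      + (\<Sum>k. L2_normsq (slab t) (Rsc (M + 1 + k)))"
    and bound: "Ests t \<le> 2 * Edet t + 2 * Esq t + Esc t" if t: "t \<in> {0<..<T}" for t
  proof -
    have le: "t \<le> T" using t by simp
    \<comment> \<open>The coefficients do not depend on \<open>t\<close>; Parseval is applied again
      on the smaller slab, to which all hypotheses restrict.\<close>
    show eq: "Ests t = (\<Sum>j\<le>M. L2_normsq (slab t) (\<lambda>z. Rdet j z + Rsq j z))
        + (\<Sum>k. L2_normsq (slab t) (Rsc (M + 1 + k)))"
      unfolding Ests split[symmetric]
      by (rule L2_L2_normsq_expansion(1)[OF \<sigma> \<sigma>s G_t[OF le] basis coeff_t[OF le] c_meas_t[OF le]])
    \<comment> \<open>Only the modes up to \<open>M\<close> are sums of two contributions and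
      acquire the factor 2; the tail is carried over unchanged.\<close>
    have "(\<Sum>j\<le>M. L2_normsq (slab t) (\<lambda>z. Rdet j z + Rsq j z))
        \<le> (\<Sum>j\<le>M. 2 * L2_normsq (slab t) (Rdet j) + 2 * L2_normsq (slab t) (Rsq j))"
      using det_L2 sq_L2 le
      by (intro sum_mono L2_normsq_add_le borel_measurable_slab_mono[OF le]) (auto simp: in_L2_def)
    then show "Ests t \<le> 2 * Edet t + 2 * Esq t + Esc t"
      unfolding eq Edet Esq Esc by (intro add_right_mono) (simp add: sum.distrib sum_distrib_left)
  qed

  have orth: "L2_L2_inner \<mu> (slab T) (S j) (S k) = 0" if "j \<noteq> k" for j k
    unfolding S_eq L2_L2_inner_product basis_bracket[OF basis] using that by simp
  show ?thesis
    using det_L2 sq_L2 sc_L2 orth lim energy bound in_L2_L2_product[OF \<sigma>s P c_L2]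
    unfolding S_eq by blast
qed

end
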